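(* Let $u^\dagger$ be the minimum norm solution of the linear inverse problem $Tu^\dagger=v^\dagger$, and suppose that $u^\dagger$ satisfies the variational source condition (VSC) stated in the context. For each $\delta>0$ let $v^\delta\in\mathcal Y$ satisfy the deterministic noise model $\|v^\dagger-v^\delta\|\le\delta$, and let $(u_i)$ be the primal iterates produced by Algorithm 2 (see context) from the data $v^\delta$. Let the iterative regularization parameter $\alpha_i(\delta,v^\delta)=\frac{1}{i(\delta,v^\delta)}$, where $i=i(\delta,v^\delta)$ is the iteration index ($i\ge1$), be chosen according to Morozov's discrepancy principle (MDP, see context), let the relaxation parameter be $\lambda\in(1,2)$, and let the step-lengths satisfy $0<\mu_i\le\frac{2}{\|T\|^2}$. Then $u_{i+1}$ converges to $u^\dagger$, i.e. $\|u_{i+1}-u^\dagger\|\to0$, as $\delta\to0$ and $i\to\infty$.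
   Context: Setting: $\mathcal X=\mathbb R^N$, $\mathcal Y=\mathbb R^M$ with Euclidean norms $\|\cdot\|$; $T:\mathcal X\to\mathcal Y$ is linear and injective, $v^\dagger\in\mathrm{range}(T)$, $\|T\|$ is the spectral norm of $T$ (square root of the largest eigenvalue of $T^TT$). $h:\mathcal X\to\{0,\infty\}$ is the indicator function of the constraint set $\Omega\subset\mathcal X$ of componentwise non-negative vectors: $h(u)=0$ for $u\in\Omega$, $h(u)=\infty$ otherwise. $D=\nabla$ is the (discrete) gradient operator, a linear map with adjoint $D^T$; $g=\|\cdot\|_1$, $g^*$ is its convex conjugate, and $J(u)=g(Du)=\|Du\|_1$ is the (discrete) total variation functional. For proper convex lower semicontinuous $f$, $\mathrm{prox}_f(\tilde u)=\arg\min_u\{f(u)+\frac12\|u-\tilde u\|^2\}$. Variational source condition (VSC): there exist a constant $\sigma\in(0,1]$ and a concave, monotonically increasing index function $\Psi:[0,\infty)\to[0,\infty)$ with $\Psi(0)=0$ such that the minimum norm solution $u^\dagger\in\mathrm{BV}(\Omega)$ (i.e. of finite total variation) satisfies $$\sigma\|u-u^\dagger\|\le J(u)-J(u^\dagger)+\Psi\left(\|Tu-Tu^\dagger\|\right)\quad\text{for all }u\in\mathcal X.$$ Morozov's discrepancy principle (MDP): for a fixed $\tau>1$, the stopping index $i^*=i^*(\delta,v^\delta)$ is such that $\|Tu_{i^*}-v^\delta\|\le\tau\delta<\|Tu_i-v^\delta\|$ for all $i<i^*$. That $\alpha_i=1/i(\delta,v^\delta)$ is chosen according to MDP means that the iteration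 indices $i=i(\delta,v^\delta)$ run up to the stopping index $i^*(\delta,v^\delta)$. Algorithm 2: the initial guess $u_0\in\mathcal X$ is constant-valued and $w_0\in\partial g(Du_0)$ is $w_0=0$. With parameters $\mu_i,\nu_i,\alpha_i>0$ ($\alpha_0>0$ a prescribed initial value) and relaxation parameter $\lambda$, for $i=0,1,2,\dots$ $$\hat u_{i+1}=\mathrm{prox}_{\mu_i h}\left[u_i-\mu_i\left(T^T(Tu_i-v^\delta)+\alpha_iD^T(w_i-w_0)\right)\right],$$ $$w_{i+1}=\mathrm{prox}_{\nu_i g^*}\left(w_i+\nu_iD\hat u_{i+1}\right),\qquad u_{i+1}=(1-\lambda)u_i+\lambda\hat u_{i+1}.$$ *)

theory Defs
  imports "HOL-Analysis.Analysis"
begin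

definition spectral_norm :: "(real^'n \<Rightarrow> real^'m) \<Rightarrow> real" where
  "spectral_norm T = sqrt (Max {l. \<exists>x. x \<noteq> 0 \<and> adjoint T (T x) = l *\<^sub>R x})"

definition nonneg_set :: "(real^'n) set" where
  "nonneg_set = {u. \<forall>i. 0 \<le> u $ i}"

definition indicator_fun :: "'a set \<Rightarrow> 'a \<Rightarrow> ereal" where
  "indicator_fun S u = (if u \<in> S then 0 else \<infinity>)"

text \<open>
  Pixels are indexed by \<open>'n\<close> and the components of the discrete gradient by \<open>'k\<close>. Every
  component is a difference quotient between two pixels with a positive spacing \<open>h\<close>; the choice
  \<open>a = b\<close> produces the zero components that Neumann boundary conditions put at the border.
  This covers forward, backward and central differences on grids of any dimension.
\<close>

definition discrete_gradient :: "(real^'n \<Rightarrow> real^'k) \<Rightarrow> bool" where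
  "discrete_gradient D \<longleftrightarrow>
     (\<forall>k. \<exists>a b h. 0 < h \<and> (\<forall>u. D u $ k = (u $ b - u $ a) / h))"

definition l1_norm :: "real^'k \<Rightarrow> real" where
  "l1_norm p = (\<Sum>k\<in>UNIV. \<bar>p $ k\<bar>)"

definition total_variation :: "(real^'n \<Rightarrow> real^'k) \<Rightarrow> real^'n \<Rightarrow> real" where
  "total_variation D u = l1_norm (D u)"

definition subdifferential :: "('a::real_inner \<Rightarrow> ereal) \<Rightarrow> 'a \<Rightarrow> 'a set" where
  "subdifferential f x =
     {w. \<bar>f x\<bar> \<noteq> \<infinity> \<and> (\<forall>y. f x + ereal (w \<bullet> (y - x)) \<le> f y)}"

definition convex_conjugate :: "('a::real_inner \<Rightarrow> ereal) \<Rightarrow> 'a \<Rightarrow> ereal" where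
  "convex_conjugate f w = (SUP x. ereal (w \<bullet> x) - f x)"

text \<open>The minimiser is unique for proper convex lower semicontinuous \<open>f\<close>.\<close>

definition prox :: "('a::real_inner \<Rightarrow> ereal) \<Rightarrow> 'a \<Rightarrow> 'a" where
  "prox f v = (ARG_MIN (\<lambda>u. f u + ereal ((norm (u - v))\<^sup>2 / 2)) u. True)"

definition minimum_norm_solution ::
    "(real^'n \<Rightarrow> real^'m) \<Rightarrow> real^'m \<Rightarrow> real^'n \<Rightarrow> bool" where
  "minimum_norm_solution T v u \<longleftrightarrow> T u = v \<and> (\<forall>x. T x = v \<longrightarrow> norm u \<le> norm x)"

text \<open>
  Concavity makes \<open>\<Psi>\<close> continuous on the open half line. Continuity at \<open>0\<close>, which some
  conventions include in the term index function, is not demanded, so that the source condition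
  below is implied by the one of either convention.
\<close>

definition index_function :: "(real \<Rightarrow> real) \<Rightarrow> bool" where
  "index_function \<Psi> \<longleftrightarrow>
     (\<forall>t\<ge>0. 0 \<le> \<Psi> t) \<and> \<Psi> 0 = 0 \<and> mono_on {0..} \<Psi>"

definition variational_source_condition ::
    "(real^'n \<Rightarrow> real^'m) \<Rightarrow> (real^'n \<Rightarrow> real) \<Rightarrow> real^'n \<Rightarrow> bool" where
  "variational_source_condition T J u\<^sub>0 \<longleftrightarrow>
     (\<exists>\<sigma> \<Psi>. 0 < \<sigma> \<and> \<sigma> \<le> 1 \<and> index_function \<Psi> \<and> concave_on {0..} \<Psi> \<and>
        (\<forall>u. \<sigma> * norm (u - u\<^sub>0) \<le> J u - J u\<^sub>0 + \<Psi> (norm (T u - T u\<^sub>0))))"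

text \<open>
  \<open>u\<close>, \<open>uhat\<close>, \<open>w\<close> are the sequences generated by the primal-dual iteration with data \<open>v\<close>,
  parameters \<open>\<alpha>\<close>, \<open>\<mu>\<close>, \<open>\<nu>\<close> and relaxation parameter \<open>lam\<close>. The value \<open>uhat 0\<close> is not used.
\<close>

definition primal_dual_iterates ::
    "(real^'n \<Rightarrow> real^'m) \<Rightarrow> (real^'n \<Rightarrow> real^'k) \<Rightarrow> real^'m \<Rightarrow>
     (nat \<Rightarrow> real) \<Rightarrow> (nat \<Rightarrow> real) \<Rightarrow> (nat \<Rightarrow> real) \<Rightarrow> real \<Rightarrow>
     (nat \<Rightarrow> real^'n) \<Rightarrow> (nat \<Rightarrow> real^'n) \<Rightarrow> (nat \<Rightarrow> real^'k) \<Rightarrow> bool" where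
  "primal_dual_iterates T D v \<alpha> \<mu> \<nu> lam u uhat w \<longleftrightarrow>
     (\<exists>c. u 0 = (\<chi> i. c)) \<and>
     w 0 = 0 \<and> w 0 \<in> subdifferential (\<lambda>p. ereal (l1_norm p)) (D (u 0)) \<and>
     (\<forall>i. uhat (Suc i) =
            prox (\<lambda>x. ereal (\<mu> i) * indicator_fun nonneg_set x)
              (u i - \<mu> i *\<^sub>R (adjoint T (T (u i) - v) + \<alpha> i *\<^sub>R adjoint D (w i - w 0))) \<and>
          w (Suc i) =
            prox (\<lambda>q. ereal (\<nu> i) * convex_conjugate (\<lambda>p. ereal (l1_norm p)) q)
              (w i + \<nu> i *\<^sub>R D (uhat (Suc i))) \<and>
          u (Suc i) = (1 - lam) *\<^sub>R u i + lam *\<^sub>R uhat (Suc i))"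

definition morozov_index ::
    "(real^'n \<Rightarrow> real^'m) \<Rightarrow> real \<Rightarrow> real \<Rightarrow> real^'m \<Rightarrow> (nat \<Rightarrow> real^'n) \<Rightarrow> nat \<Rightarrow> bool" where
  "morozov_index T \<tau> \<delta> v u i \<longleftrightarrow>
     norm (T (u i) - v) \<le> \<tau> * \<delta> \<and> (\<forall>j<i. \<tau> * \<delta> < norm (T (u j) - v))"

end

theory Submission
  imports Defs
begin

text \<open>
  Everything happens at a stopping index \<open>i\<close>. There the discrepancy principle and the noise model
  give \<open>norm (T (u\<^sub>i - u\<^sup>\<dagger>)) \<le> (\<tau> + 1) * \<delta>\<close>, and an injective linear map between finite-dimensional
  spaces is bounded below, so \<open>u\<^sub>i\<close> itself is within \<open>O(\<delta>)\<close> of \<open>u\<^sup>\<dagger>\<close>.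

  It remains to see that one more step of the iteration does not leave this neighbourhood. The
  argument of the primal prox differs from \<open>u\<^sub>i\<close> by a bounded step length times the sum of the
  gradient of the data term, which is \<open>O(\<tau> * \<delta>)\<close> by the discrepancy principle, and of
  \<open>\<alpha>\<^sub>i D\<^sup>T w\<^sub>i\<close>, which is \<open>O(1 / i)\<close>: the conjugate of the 1-norm is the indicator function of the unit
  cube, so each dual iterate is a projection onto the cube and hence bounded
  (\<open>norm_dual_iterate_le\<close>). The primal prox is a projection onto a set that contains \<open>u\<^sup>\<dagger>\<close>, so it at
  most doubles the distance to \<open>u\<^sup>\<dagger>\<close> (\<open>prox_scaled_indicator_dist\<close>), and relaxation takes a fixed
  affine combination. Altogether \<open>norm (u\<^sub>i\<^sub>+\<^sub>1 - u\<^sup>\<dagger>) \<le> a * \<delta> + b / i\<close> with constants \<open>a\<close> and \<open>b\<close> that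
  depend neither on \<open>\<delta>\<close> nor on \<open>i\<close>.
\<close>

text \<open>
  Outside \<open>S\<close> the objective is infinite, so minimising it means minimising the distance over \<open>S\<close>.
\<close>

lemma prox_scaled_indicator:
  fixes S :: "'a::euclidean_space set"
  assumes "closed S" and "S \<noteq> {}" and "0 < c"
  defines "p \<equiv> \<lambda>v. prox (\<lambda>x. ereal c * indicator_fun S x) v"
  shows prox_scaled_indicator_in: "p v \<in> S"
    and prox_scaled_indicator_closest: "y \<in> S \<Longrightarrow> norm (p v - v) \<le> norm (y - v)"
proof -
  define F where "F = (\<lambda>x. ereal c * indicator_fun S x + ereal ((norm (x - v))\<^sup>2 / 2))"
  have F_in: "F x = ereal ((norm (x - v))\<^sup>2 / 2)" if "x \<in> S" for x
    using that by (simp add: F_def indicator_fun_def)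
  have F_out: "F x = \<infinity>" if "x \<notin> S" for x
    using that \<open>0 < c\<close> by (simp add: F_def indicator_fun_def)
  obtain x where x: "x \<in> S" and closest: "\<And>y. y \<in> S \<Longrightarrow> dist v x \<le> dist v y"
    by (rule distance_attains_inf[of S v, OF \<open>closed S\<close> \<open>S \<noteq> {}\<close>]) (rule that, assumption, blast)
  have "F x \<le> F y" for y
  proof (cases "y \<in> S")
    case True
    then have "norm (x - v) \<le> norm (y - v)"
      using closest[of y] by (simp add: dist_norm norm_minus_commute)
    then show ?thesis
      using True x by (simp add: F_in power_mono)
  qed (simp add: F_out)
  then have "is_arg_min F (\<lambda>_. True) x"
    by (simp add: is_arg_min_def not_less)
  then have "is_arg_min F (\<lambda>_. True) (p v)"
    unfolding p_def prox_def arg_min_def F_def by (rule someI)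
  then have min: "F (p v) \<le> F y" for y
    by (simp add: is_arg_min_def not_less)
  show in_S: "p v \<in> S"
    using min[of x] x by (cases "p v \<in> S") (simp_all add: F_in F_out)
  show "norm (p v - v) \<le> norm (y - v)" if "y \<in> S"
    using min[of y] that in_S by (simp add: F_in)
qed

lemma prox_scaled_indicator_dist:
  fixes S :: "'a::euclidean_space set"
  assumes "closed S" and "y \<in> S" and "0 < c"
  shows "norm (prox (\<lambda>x. ereal c * indicator_fun S x) v - y) \<le> 2 * norm (v - y)"
proof -
  let ?p = "prox (\<lambda>x. ereal c * indicator_fun S x) v"
  have "norm (?p - v) \<le> norm (y - v)"
    using assms by (intro prox_scaled_indicator_closest) auto
  moreover have "norm (?p - y) \<le> norm (?p - v) + norm (v - y)"
    using norm_triangle_ineq[of "?p - v" "v - y"] by simp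
  ultimately show ?thesis
    by (simp add: norm_minus_commute)
qed

lemma closed_nonneg_set: "closed (nonneg_set :: (real^'n) set)"
  unfolding nonneg_set_def by (intro closed_Collect_all closed_Collect_le continuous_intros)

text \<open>
  If \<open>w\<close> lies in the cube, then \<open>w \<bullet> x - l1_norm x \<le> 0\<close> with equality at the origin. If some
  \<open>\<bar>w $ k\<bar>\<close> exceeds 1, the same expression is unbounded along the ray spanned by the \<open>k\<close>-th unit
  vector with the sign of \<open>w $ k\<close>.
\<close>

lemma convex_conjugate_l1_norm:
  "convex_conjugate (\<lambda>p. ereal (l1_norm p)) = indicator_fun {w :: real^'k. \<forall>k. \<bar>w $ k\<bar> \<le> 1}"
proof
  fix w :: "real^'k"
  let ?f = "\<lambda>x. ereal (w \<bullet> x) - ereal (l1_norm x)"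
  show "convex_conjugate (\<lambda>p. ereal (l1_norm p)) w
      = indicator_fun {w :: real^'k. \<forall>k. \<bar>w $ k\<bar> \<le> 1} w"
  proof (cases "\<forall>k. \<bar>w $ k\<bar> \<le> 1")
    case True
    have "w \<bullet> x \<le> l1_norm x" for x
      unfolding inner_vec_def l1_norm_def
    proof (rule sum_mono)
      fix k
      have "w $ k * x $ k \<le> \<bar>w $ k\<bar> * \<bar>x $ k\<bar>"
        using abs_ge_self[of "w $ k * x $ k"] by (simp add: abs_mult)
      also have "\<dots> \<le> \<bar>x $ k\<bar>"
        using True by (simp add: mult_left_le_one_le)
      finally show "w $ k \<bullet> x $ k \<le> \<bar>x $ k\<bar>" by simp
    qed
    then have "?f x \<le> 0" for x
      by (simp add: zero_ereal_def)
    moreover have "?f 0 = 0"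
      by (simp add: l1_norm_def zero_ereal_def)
    ultimately have "(SUP x. ?f x) = 0"
      by (intro antisym SUP_least) (auto intro: SUP_upper2[of 0])
    then show ?thesis
      using True by (simp add: convex_conjugate_def indicator_fun_def)
  next
    case False
    then obtain k where k: "1 < \<bar>w $ k\<bar>"
      by (auto simp: not_le)
    have "\<exists>x. ereal (real n) \<le> ?f x" for n
    proof -
      define t where "t = real n / (\<bar>w $ k\<bar> - 1)"
      define x where "x = axis k (t * sgn (w $ k))"
      have "0 \<le> t"
        using k by (simp add: t_def)
      have inner: "w \<bullet> x = t * \<bar>w $ k\<bar>"
        by (simp add: x_def inner_axis abs_sgn)
      have "l1_norm x = (\<Sum>j\<in>UNIV. if j = k then \<bar>t * sgn (w $ k)\<bar> else 0)"
        unfolding l1_norm_def x_def by (intro sum.cong) (auto simp: axis_def)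
      also have "\<dots> = t"
        using k \<open>0 \<le> t\<close> by (auto simp: abs_mult abs_sgn_eq)
      finally have "w \<bullet> x - l1_norm x = t * (\<bar>w $ k\<bar> - 1)"
        using inner by (simp add: algebra_simps)
      also have "\<dots> = real n"
        using k by (simp add: t_def)
      finally show ?thesis
        by (intro exI[of _ x]) simp
    qed
    then have "(SUP x. ?f x) = \<infinity>"
      by (intro SUP_PInfty) auto
    then show ?thesis
      using False by (simp add: convex_conjugate_def indicator_fun_def)
  qed
qed

lemma norm_dual_iterate_le:
  fixes u uhat :: "nat \<Rightarrow> real^'n" and w :: "nat \<Rightarrow> real^'k"
  assumes "primal_dual_iterates T D v \<alpha> \<mu> \<nu> lam u uhat w" and "\<And>i. 0 < \<nu> i"
  shows "norm (w i) \<le> real CARD('k)"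
proof (cases i)
  case 0
  then show ?thesis
    using assms(1) by (simp add: primal_dual_iterates_def)
next
  case (Suc j)
  let ?C = "{w :: real^'k. \<forall>k. \<bar>w $ k\<bar> \<le> 1}"
  have "w i = prox (\<lambda>q. ereal (\<nu> j) * indicator_fun ?C q) (w j + \<nu> j *\<^sub>R D (uhat (Suc j)))"
    using assms(1) by (simp add: Suc primal_dual_iterates_def convex_conjugate_l1_norm)
  moreover have "closed ?C"
    by (intro closed_Collect_all closed_Collect_le continuous_intros)
  moreover have "0 \<in> ?C"
    by simp
  then have "?C \<noteq> {}"
    by blast
  ultimately have "w i \<in> ?C"
    using prox_scaled_indicator_in[of ?C "\<nu> j" "w j + \<nu> j *\<^sub>R D (uhat (Suc j))"] assms(2)
    by simp
  then have "(\<Sum>k\<in>UNIV. \<bar>w i $ k\<bar>) \<le> (\<Sum>k\<in>(UNIV :: 'k set). 1)"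
    by (intro sum_mono) simp
  then show ?thesis
    using norm_le_l1_cart[of "w i"] by simp
qed

text \<open>
  The relaxed step is the combination of \<open>u i\<close> and \<open>uhat (Suc i)\<close> with weights \<open>1 - lam\<close> and \<open>lam\<close>.
  The distance of \<open>uhat (Suc i)\<close> from \<open>y\<close> is at most twice that of the argument of the prox, so the
  initial error enters with the factor \<open>(lam - 1) + 2 * lam\<close>.
\<close>

lemma primal_step_dist:
  fixes u uhat :: "nat \<Rightarrow> real^'n" and w :: "nat \<Rightarrow> real^'k"
  assumes iter: "primal_dual_iterates T D v \<alpha> \<mu> \<nu> lam u uhat w"
    and "y \<in> nonneg_set" and "1 \<le> lam" and "0 < \<mu> i"
  shows "norm (u (Suc i) - y) \<le> (3 * lam - 1) * norm (u i - y)
    + 2 * lam * \<mu> i * (norm (adjoint T (T (u i) - v)) + \<bar>\<alpha> i\<bar> * norm (adjoint D (w i)))"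
proof -
  define g where "g = adjoint T (T (u i) - v) + \<alpha> i *\<^sub>R adjoint D (w i)"
  have "w 0 = 0"
    using iter by (simp add: primal_dual_iterates_def)
  then have uhat: "uhat (Suc i) = prox (\<lambda>x. ereal (\<mu> i) * indicator_fun nonneg_set x)
      (u i - \<mu> i *\<^sub>R g)"
    and u: "u (Suc i) = (1 - lam) *\<^sub>R u i + lam *\<^sub>R uhat (Suc i)"
    using iter by (simp_all add: primal_dual_iterates_def g_def)
  have "norm (uhat (Suc i) - y) \<le> 2 * norm (u i - \<mu> i *\<^sub>R g - y)"
    unfolding uhat using assms by (intro prox_scaled_indicator_dist closed_nonneg_set)
  also have "norm (u i - \<mu> i *\<^sub>R g - y) \<le> norm (u i - y) + \<mu> i * norm g"
    using norm_triangle_ineq4[of "u i - y" "\<mu> i *\<^sub>R g"] \<open>0 < \<mu> i\<close> by (simp add: algebra_simps)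
  finally have hat: "lam * norm (uhat (Suc i) - y) \<le> lam * (2 * (norm (u i - y) + \<mu> i * norm g))"
    using \<open>1 \<le> lam\<close> by (intro mult_left_mono) auto
  have "norm g \<le> norm (adjoint T (T (u i) - v)) + \<bar>\<alpha> i\<bar> * norm (adjoint D (w i))"
    unfolding g_def by (metis norm_scaleR norm_triangle_ineq)
  then have g: "2 * lam * \<mu> i * norm g
      \<le> 2 * lam * \<mu> i * (norm (adjoint T (T (u i) - v)) + \<bar>\<alpha> i\<bar> * norm (adjoint D (w i)))"
    using assms by (intro mult_left_mono) auto
  have "u (Suc i) - y = (1 - lam) *\<^sub>R (u i - y) + lam *\<^sub>R (uhat (Suc i) - y)"
    unfolding u by (simp add: algebra_simps)
  then have "norm (u (Suc i) - y) \<le> \<bar>1 - lam\<bar> * norm (u i - y) + \<bar>lam\<bar> * norm (uhat (Suc i) - y)"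
    by (metis norm_scaleR norm_triangle_ineq)
  also have "\<dots> = (lam - 1) * norm (u i - y) + lam * norm (uhat (Suc i) - y)"
    using \<open>1 \<le> lam\<close> by simp
  also have "\<dots> \<le> (3 * lam - 1) * norm (u i - y) + 2 * lam * \<mu> i * norm g"
    using hat by (simp add: algebra_simps)
  finally show ?thesis
    using g by linarith
qed

theorem theorem5p6:
  fixes T :: "real^'n \<Rightarrow> real^'m"
    and D :: "real^'n \<Rightarrow> real^'k"
    and v\<^sub>d :: "real^'m" and u\<^sub>d :: "real^'n"
    and v :: "real \<Rightarrow> real^'m"
    and \<alpha> :: "nat \<Rightarrow> real" and \<mu> \<nu> :: "real \<Rightarrow> nat \<Rightarrow> real"
    and lam \<tau> :: real
    and u uhat :: "real \<Rightarrow> nat \<Rightarrow> real^'n" and w :: "real \<Rightarrow> nat \<Rightarrow> real^'k"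
  assumes "linear T" and "inj T" and "v\<^sub>d \<in> range T"
    and "discrete_gradient D"
    and "minimum_norm_solution T v\<^sub>d u\<^sub>d" and "u\<^sub>d \<in> nonneg_set"
    and "variational_source_condition T (total_variation D) u\<^sub>d"
    and "\<And>\<delta>. 0 < \<delta> \<Longrightarrow> norm (v\<^sub>d - v \<delta>) \<le> \<delta>"
    and "0 < \<alpha> 0" and "\<And>i. 1 \<le> i \<Longrightarrow> \<alpha> i = 1 / real i"
    and "1 < lam" and "lam < 2" and "1 < \<tau>"
    and "\<And>\<delta> i. 0 < \<delta> \<Longrightarrow> 0 < \<mu> \<delta> i \<and> \<mu> \<delta> i \<le> 2 / (spectral_norm T)\<^sup>2"
    and "\<And>\<delta> i. 0 < \<delta> \<Longrightarrow> 0 < \<nu> \<delta> i"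
    and "\<And>\<delta>. 0 < \<delta> \<Longrightarrow>
           primal_dual_iterates T D (v \<delta>) \<alpha> (\<mu> \<delta>) (\<nu> \<delta>) lam (u \<delta>) (uhat \<delta>) (w \<delta>)"
  shows "((\<lambda>(\<delta>, i). norm (u \<delta> (Suc i) - u\<^sub>d)) \<longlongrightarrow> 0)
           (inf (at_right 0 \<times>\<^sub>F at_top) (principal {(\<delta>, i). morozov_index T \<tau> \<delta> (v \<delta>) (u \<delta>) i}))"
proof -
  let ?F = "inf (at_right 0 \<times>\<^sub>F at_top)
    (principal {(\<delta>, i). morozov_index T \<tau> \<delta> (v \<delta>) (u \<delta>) i})"
  define K where "K = 2 / (spectral_norm T)\<^sup>2"
  define N where "N = real CARD('k)"
  have "linear D"
  proof (rule linearI)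
    fix x y :: "real^'n" and c :: real
    show "D (x + y) = D x + D y"
      unfolding vec_eq_iff
    proof
      fix k
      obtain a b h where "\<And>u. D u $ k = (u $ b - u $ a) / h"
        using assms(4) unfolding discrete_gradient_def by blast
      then show "D (x + y) $ k = (D x + D y) $ k"
        by (simp add: diff_divide_distrib add_divide_distrib)
    qed
    show "D (c *\<^sub>R x) = c *\<^sub>R D x"
      unfolding vec_eq_iff
    proof
      fix k
      obtain a b h where "\<And>u. D u $ k = (u $ b - u $ a) / h"
        using assms(4) unfolding discrete_gradient_def by blast
      then show "D (c *\<^sub>R x) $ k = (c *\<^sub>R D x) $ k"
        by (simp add: right_diff_distrib)
    qed
  qed
  obtain B where B: "0 < B" "\<And>x. B * norm x \<le> norm (T x)"
    using linear_inj_bounded_below_pos[OF assms(1,2)] by blast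
  obtain A where A: "0 < A" "\<And>x. norm (adjoint T x) \<le> A * norm x"
    using linear_bounded_pos[OF adjoint_linear[OF assms(1)]] by blast
  obtain A' where A': "0 < A'" "\<And>x. norm (adjoint D x) \<le> A' * norm x"
    using linear_bounded_pos[OF adjoint_linear[OF \<open>linear D\<close>]] by blast
  define bound where "bound = (\<lambda>\<delta> i. (3 * lam - 1) * ((\<tau> + 1) * \<delta> / B)
    + 2 * lam * K * (A * (\<tau> * \<delta>) + 1 / real i * (A' * N)))"
  have le_bound: "norm (u \<delta> (Suc i) - u\<^sub>d) \<le> bound \<delta> i"
    if "0 < \<delta>" and "1 \<le> i" and stop: "morozov_index T \<tau> \<delta> (v \<delta>) (u \<delta>) i" for \<delta> i
  proof -
    have \<mu>: "0 < \<mu> \<delta> i" "\<mu> \<delta> i \<le> K"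
      using assms(14)[OF \<open>0 < \<delta>\<close>] by (auto simp: K_def)
    have iter: "primal_dual_iterates T D (v \<delta>) \<alpha> (\<mu> \<delta>) (\<nu> \<delta>) lam (u \<delta>) (uhat \<delta>) (w \<delta>)"
      by (rule assms(16)[OF \<open>0 < \<delta>\<close>])
    have res: "norm (T (u \<delta> i) - v \<delta>) \<le> \<tau> * \<delta>"
      using stop by (simp add: morozov_index_def)
    have "T (u \<delta> i - u\<^sub>d) = (T (u \<delta> i) - v \<delta>) - (v\<^sub>d - v \<delta>)"
      using assms(1,5) by (simp add: linear_diff minimum_norm_solution_def)
    then have "norm (T (u \<delta> i - u\<^sub>d)) \<le> norm (T (u \<delta> i) - v \<delta>) + norm (v\<^sub>d - v \<delta>)"
      by (metis norm_triangle_ineq4)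
    then have "B * norm (u \<delta> i - u\<^sub>d) \<le> (\<tau> + 1) * \<delta>"
      using B(2)[of "u \<delta> i - u\<^sub>d"] res assms(8)[OF \<open>0 < \<delta>\<close>] by (simp add: algebra_simps)
    then have err: "norm (u \<delta> i - u\<^sub>d) \<le> (\<tau> + 1) * \<delta> / B"
      using \<open>0 < B\<close> by (simp add: field_simps)
    have "norm (adjoint T (T (u \<delta> i) - v \<delta>)) \<le> A * (\<tau> * \<delta>)"
      using A(2) mult_left_mono[OF res, of A] \<open>0 < A\<close> by (meson less_imp_le order_trans)
    moreover have "norm (w \<delta> i) \<le> N"
      unfolding N_def using iter assms(15)[OF \<open>0 < \<delta>\<close>] by (rule norm_dual_iterate_le)
    then have "norm (adjoint D (w \<delta> i)) \<le> A' * N"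
      using A'(2) mult_left_mono[of "norm (w \<delta> i)" N A'] \<open>0 < A'\<close>
      by (meson less_imp_le order_trans)
    then have "\<bar>\<alpha> i\<bar> * norm (adjoint D (w \<delta> i)) \<le> 1 / real i * (A' * N)"
      unfolding assms(10)[OF \<open>1 \<le> i\<close>] by (simp add: divide_right_mono)
    ultimately have step: "norm (adjoint T (T (u \<delta> i) - v \<delta>)) + \<bar>\<alpha> i\<bar> * norm (adjoint D (w \<delta> i))
        \<le> A * (\<tau> * \<delta>) + 1 / real i * (A' * N)"
      by linarith
    have "norm (u \<delta> (Suc i) - u\<^sub>d) \<le> (3 * lam - 1) * norm (u \<delta> i - u\<^sub>d)
      + 2 * lam * \<mu> \<delta> i * (norm (adjoint T (T (u \<delta> i) - v \<delta>)) + \<bar>\<alpha> i\<bar> * norm (adjoint D (w \<delta> i)))"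
      using assms(11) \<mu>(1) by (intro primal_step_dist[OF iter assms(6)]) auto
    also have "\<dots> \<le> bound \<delta> i"
      unfolding bound_def using assms(11) \<mu>
      by (intro add_mono mult_left_mono[OF err] mult_mono[OF _ step]) auto
    finally show ?thesis .
  qed
  have pos: "\<forall>\<^sub>F (\<delta>, i) in at_right (0::real) \<times>\<^sub>F at_top. 0 < \<delta> \<and> (1::nat) \<le> i"
    using eventually_prodI[OF eventually_at_right_less eventually_ge_at_top, of "0::real" "1::nat"]
    by (simp only: case_prod_unfold)
  have \<delta>_lim: "((\<lambda>x. fst x) \<longlongrightarrow> 0) (at_right (0::real) \<times>\<^sub>F (at_top :: nat filter))"
    by (rule filterlim_compose[OF _ filterlim_fst]) (rule tendsto_ident_at)
  have i_lim: "((\<lambda>x. 1 / real (snd x)) \<longlongrightarrow> 0) (at_right (0::real) \<times>\<^sub>F (at_top :: nat filter))"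
    by (rule filterlim_compose[OF lim_1_over_n filterlim_snd])
  have "((\<lambda>x. bound (fst x) (snd x)) \<longlongrightarrow> (3 * lam - 1) * ((\<tau> + 1) * 0 / B)
      + 2 * lam * K * (A * (\<tau> * 0) + 0 * (A' * N))) (at_right 0 \<times>\<^sub>F at_top)"
    unfolding bound_def using \<open>0 < B\<close> by (intro tendsto_intros \<delta>_lim i_lim) auto
  then have "((\<lambda>x. bound (fst x) (snd x)) \<longlongrightarrow> 0) ?F"
    by (auto intro: tendsto_mono[OF inf_le1])
  then have bound_lim: "((\<lambda>(\<delta>, i). bound \<delta> i) \<longlongrightarrow> 0) ?F"
    by (simp only: case_prod_unfold)
  have nonneg: "\<forall>\<^sub>F x in ?F. 0 \<le> (case x of (\<delta>, i) \<Rightarrow> norm (u \<delta> (Suc i) - u\<^sub>d))"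
    by (intro always_eventually) auto
  have upper: "\<forall>\<^sub>F x in ?F. (case x of (\<delta>, i) \<Rightarrow> norm (u \<delta> (Suc i) - u\<^sub>d))
      \<le> (case x of (\<delta>, i) \<Rightarrow> bound \<delta> i)"
    unfolding eventually_inf_principal using pos
    by eventually_elim (auto intro: le_bound)
  show ?thesis
    by (rule tendsto_sandwich[OF nonneg upper tendsto_const bound_lim])
qed

end
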